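(* Let $a,b,k$ be positive integers with $(a+b)/\gcd(a,b)=2^k$. Then $(a,b)$ is pourable in exactly $k$ steps.
   Context: Let $\mathbb{N}$ denote the positive integers and $\mathbb{N}_0=\mathbb{N}\cup\{0\}$. The two-dimensional pouring function $f:\mathbb{N}^2\to\mathbb{N}_0^2$ is defined by $f(a,b)=(2a,b-a)$ if $a\le b$, and $f(a,b)=(a-b,2b)$ otherwise. A state $(a,b)\in\mathbb{N}^2$ is called pourable if there is $p\in\mathbb{N}$ with $f^p(a,b)=(a+b,0)$, where $f^p$ is the $p$-fold iterate of $f$ (all intermediate iterates lying in $\mathbb{N}^2$). Such a $p$ is then unique, since the process stops once a vessel is empty, and the state is said to be pourable in exactly $p$ steps. *)

theory Defs
  imports Main
begin

definition positive_states :: "(nat \<times> nat) set" where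
  "positive_states = {(a, b). 0 < a \<and> 0 < b}"

(* The pouring function has domain positive_states; its values elsewhere carry no meaning.
   Every subtraction below is exact. *)
definition pour :: "nat \<times> nat \<Rightarrow> nat \<times> nat" where
  "pour = (\<lambda>(a, b). if a \<le> b then (2 * a, b - a) else (a - b, 2 * b))"

(* The condition on the intermediate iterates expresses that pouring stops once a vessel is
   empty. It is essential: the total function pour fixes (n, 0) for n > 0, so without it
   every larger p would also qualify. *)
definition pourable_in_exactly :: "nat \<Rightarrow> nat \<times> nat \<Rightarrow> bool" where
  "pourable_in_exactly p s \<longleftrightarrow>
     0 < p \<and> (\<forall>i<p. (pour ^^ i) s \<in> positive_states) \<and> (pour ^^ p) s = (fst s + snd s, 0)"

definition pourable :: "nat \<times> nat \<Rightarrow> bool" where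
  "pourable s \<longleftrightarrow> (\<exists>p. pourable_in_exactly p s)"

lemma pourable_in_exactly_unique:
  assumes "pourable_in_exactly p s" and "pourable_in_exactly q s"
  shows "p = q"
proof -
  have "\<not> m < n" if "pourable_in_exactly m s" "pourable_in_exactly n s" for m n
  proof
    assume "m < n"
    then have "(pour ^^ m) s \<in> positive_states"
      using that(2) by (simp add: pourable_in_exactly_def)
    then show False
      using that(1) by (simp add: pourable_in_exactly_def positive_states_def)
  qed
  then show ?thesis
    using assms by (meson linorder_neqE_nat)
qed

end

theory Submission
  imports Defs
begin

text \<open>Divide the state by its greatest common divisor. If the total is \<open>2 ^ k\<close> with \<open>k > 1\<close>, the two
  reduced entries are odd and distinct, so one pouring step makes both entries even; halving
  them leaves an odd entry and total \<open>2 ^ (k - 1)\<close>. Only the state \<open>(1, 1)\<close> has total \<open>2\<close>, and one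
  step empties a vessel.\<close>

text \<open>A step conserves the total, so \<open>s\<close> and \<open>pour s\<close> have the same
  final state.\<close>

lemma pourable_in_exactly_Suc:
  assumes "s \<in> positive_states" and "pourable_in_exactly p (pour s)"
  shows "pourable_in_exactly (Suc p) s"
proof -
  have "fst (pour s) + snd (pour s) = fst s + snd s"
    by (auto simp: pour_def split: prod.splits)
  moreover have "(pour ^^ i) s \<in> positive_states" if "i < Suc p" for i
    using that assms by (cases i) (auto simp: pourable_in_exactly_def funpow_swap1)
  ultimately show ?thesis
    using assms(2) by (auto simp: pourable_in_exactly_def funpow_swap1)
qed

text \<open>As the total is a positive power of 2, oddness of \<open>x\<close> amounts to
  coprimality of \<open>x\<close> and \<open>y\<close>, and parity is easier to follow through a
  step. The factor 2 created by each step is moved into \<open>g\<close>, which therefore varies in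
  the induction.\<close>

lemma pourable_in_exactly_odd:
  fixes g x y :: nat
  assumes "0 < g" and "odd x" and "x + y = 2 ^ Suc k"
  shows "pourable_in_exactly (Suc k) (g * x, g * y)"
  using assms
proof (induction k arbitrary: g x y)
  case 0
  then have "x + y = 2"
    by simp
  with \<open>odd x\<close> have "x = 1" "y = 1"
    by presburger+
  with \<open>0 < g\<close> show ?case
    by (simp add: pourable_in_exactly_def positive_states_def pour_def)
next
  case (Suc k)
  have "even (x + y)"
    using Suc.prems(3) by simp
  then have "odd y"
    using Suc.prems(2) by simp
  have pos: "(g * x, g * y) \<in> positive_states"
    using Suc.prems \<open>odd y\<close> by (auto simp: positive_states_def odd_pos)
  show ?case
  proof (cases "x \<le> y")
    case True
    then obtain z where z: "y = x + 2 * z"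
      using Suc.prems(2) \<open>odd y\<close> by (metis dvdE even_add le_add_diff_inverse)
    \<comment> \<open>The odd entry \<open>x\<close> stays in first place, and \<open>x + z\<close>
      is half of the old total.\<close>
    have "pourable_in_exactly (Suc k) (2 * g * x, 2 * g * z)"
      using Suc.prems z by (intro Suc.IH) auto
    moreover have "pour (g * x, g * y) = (2 * g * x, 2 * g * z)"
      by (simp add: pour_def z algebra_simps)
    ultimately show ?thesis
      using pourable_in_exactly_Suc[OF pos] by simp
  next
    case False
    then obtain z where z: "x = y + 2 * z"
      using Suc.prems(2) \<open>odd y\<close> by (metis dvdE even_add le_add_diff_inverse nat_le_linear)
    \<comment> \<open>The first entry is now \<open>z\<close>; its oddness comes from the odd
      \<open>y\<close> and the halved total, which is still even.\<close>
    have sum: "z + y = 2 ^ Suc k"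
      using Suc.prems(3) z by simp
    then have "even (z + y)"
      by simp
    then have "odd z"
      using \<open>odd y\<close> by simp
    then have "pourable_in_exactly (Suc k) (2 * g * z, 2 * g * y)"
      using \<open>0 < g\<close> sum by (intro Suc.IH) auto
    moreover have "pour (g * x, g * y) = (2 * g * z, 2 * g * y)"
      using False \<open>0 < g\<close> by (simp add: pour_def z algebra_simps)
    ultimately show ?thesis
      using pourable_in_exactly_Suc[OF pos] by simp
  qed
qed

theorem theorem10:
  fixes a b k :: nat
  assumes "0 < a" and "0 < b" and "0 < k"
    and "(a + b) div gcd a b = 2 ^ k"
  shows "pourable_in_exactly k (a, b)"
proof -
  define g where "g = gcd a b"
  have g: "0 < g"
    using assms(1) by (simp add: g_def)
  obtain x y where xy: "a = g * x" "b = g * y" and "coprime x y"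
    using gcd_coprime_exists[of a b] assms(1) unfolding g_def by (metis gcd_pos_nat less_irrefl mult.commute)
  obtain m where m: "k = Suc m"
    using assms(3) by (cases k) auto
  have "a + b = g * (x + y)"
    using xy by (simp add: algebra_simps)
  then have sum: "x + y = 2 ^ Suc m"
    using assms(4) g m unfolding g_def[symmetric] by simp
  then have "even (x + y)"
    by simp
  \<comment> \<open>If \<open>x\<close> were even, the even total would make 2 a common divisor of
    \<open>x\<close> and \<open>y\<close>.\<close>
  then have "odd x"
    using \<open>coprime x y\<close> by (metis coprime_common_divisor even_add odd_one)
  then show ?thesis
    using pourable_in_exactly_odd[OF g _ sum] xy m by simp
qed

end
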